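(* Let $\Gamma$ be a Neumaier graph on $v$ vertices with valency $k$, in which any two adjacent vertices have exactly $\lambda$ common neighbours, and let $s$ and $e$ be as defined in the context. If every clique of $\Gamma$ of order $e+1$ is contained in a clique of order $s+1$, then $\Gamma$ is strongly regular.
   Context: A graph is edge-regular if it is regular and any two adjacent vertices have the same number $\lambda$ of common neighbours. A clique $C$ in a regular graph is a regular clique if every vertex outside $C$ is adjacent to the same positive number of vertices of $C$. A Neumaier graph is a non-complete edge-regular graph containing a regular clique. For a non-complete edge-regular graph $\Gamma$ on $v$ vertices with valency $k\ge 1$ and parameter $\lambda$: if $\Gamma$ is a complete multipartite graph, $s+1$ denotes its number of parts; otherwise $$s:=\frac{-(k^2-k+\lambda-v\lambda)+\sqrt{(k^2-k+\lambda-v\lambda)^2+4k(v-k-1)(v+\lambda-2k)}}{2(v+\lambda-2k)}.$$ Further $e:=\frac{(s+1)(k-s)}{v-(s+1)}$. (For a Neumaier graph the regular cliques have exactly $s+1$ vertices and every vertex outside such a clique is adjacent to exactly $e$ of its vertices.) *)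

theory Defs
  imports Complex_Main "HOL-Library.Disjoint_Sets"
begin

definition simple_graph :: "'a set \<Rightarrow> ('a \<Rightarrow> 'a \<Rightarrow> bool) \<Rightarrow> bool" where
  "simple_graph V E \<longleftrightarrow> finite V
     \<and> (\<forall>x y. E x y \<longrightarrow> x \<in> V \<and> y \<in> V \<and> x \<noteq> y \<and> E y x)"

definition nbhd :: "'a set \<Rightarrow> ('a \<Rightarrow> 'a \<Rightarrow> bool) \<Rightarrow> 'a \<Rightarrow> 'a set" where
  "nbhd V E x = {y \<in> V. E x y}"

definition complete_graph :: "'a set \<Rightarrow> ('a \<Rightarrow> 'a \<Rightarrow> bool) \<Rightarrow> bool" where
  "complete_graph V E \<longleftrightarrow> (\<forall>x\<in>V. \<forall>y\<in>V. x \<noteq> y \<longrightarrow> E x y)"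

definition regular_graph :: "'a set \<Rightarrow> ('a \<Rightarrow> 'a \<Rightarrow> bool) \<Rightarrow> nat \<Rightarrow> bool" where
  "regular_graph V E k \<longleftrightarrow> simple_graph V E \<and> (\<forall>x\<in>V. card (nbhd V E x) = k)"

definition edge_regular :: "'a set \<Rightarrow> ('a \<Rightarrow> 'a \<Rightarrow> bool) \<Rightarrow> nat \<Rightarrow> nat \<Rightarrow> bool" where
  "edge_regular V E k l \<longleftrightarrow> regular_graph V E k
     \<and> (\<forall>x\<in>V. \<forall>y\<in>V. E x y \<longrightarrow> card (nbhd V E x \<inter> nbhd V E y) = l)"

text \<open>Complete and edgeless graphs are not counted as strongly regular.\<close>

definition strongly_regular :: "'a set \<Rightarrow> ('a \<Rightarrow> 'a \<Rightarrow> bool) \<Rightarrow> bool" where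
  "strongly_regular V E \<longleftrightarrow> \<not> complete_graph V E \<and> (\<exists>x\<in>V. \<exists>y\<in>V. E x y)
     \<and> (\<exists>k l. edge_regular V E k l)
     \<and> (\<exists>m. \<forall>x\<in>V. \<forall>y\<in>V. x \<noteq> y \<and> \<not> E x y \<longrightarrow> card (nbhd V E x \<inter> nbhd V E y) = m)"

definition clique :: "'a set \<Rightarrow> ('a \<Rightarrow> 'a \<Rightarrow> bool) \<Rightarrow> 'a set \<Rightarrow> bool" where
  "clique V E C \<longleftrightarrow> C \<subseteq> V \<and> (\<forall>x\<in>C. \<forall>y\<in>C. x \<noteq> y \<longrightarrow> E x y)"

definition regular_clique :: "'a set \<Rightarrow> ('a \<Rightarrow> 'a \<Rightarrow> bool) \<Rightarrow> 'a set \<Rightarrow> bool" where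
  "regular_clique V E C \<longleftrightarrow> clique V E C
     \<and> (\<exists>m>0. \<forall>x\<in>V - C. card (nbhd V E x \<inter> C) = m)"

definition neumaier_graph :: "'a set \<Rightarrow> ('a \<Rightarrow> 'a \<Rightarrow> bool) \<Rightarrow> nat \<Rightarrow> nat \<Rightarrow> bool" where
  "neumaier_graph V E k l \<longleftrightarrow> edge_regular V E k l \<and> \<not> complete_graph V E
     \<and> (\<exists>C. regular_clique V E C)"

definition multipartition :: "'a set \<Rightarrow> ('a \<Rightarrow> 'a \<Rightarrow> bool) \<Rightarrow> 'a set set \<Rightarrow> bool" where
  "multipartition V E P \<longleftrightarrow> partition_on V P
     \<and> (\<forall>x\<in>V. \<forall>y\<in>V. E x y \<longleftrightarrow> \<not> (\<exists>A\<in>P. x \<in> A \<and> y \<in> A))"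

definition complete_multipartite :: "'a set \<Rightarrow> ('a \<Rightarrow> 'a \<Rightarrow> bool) \<Rightarrow> bool" where
  "complete_multipartite V E \<longleftrightarrow> (\<exists>P. multipartition V E P)"

definition num_parts :: "'a set \<Rightarrow> ('a \<Rightarrow> 'a \<Rightarrow> bool) \<Rightarrow> nat" where
  "num_parts V E = card (THE P. multipartition V E P)"

lemma multipartition_eq:
  assumes "multipartition V E P"
  shows "P = {{y \<in> V. \<not> E x y} | x. x \<in> V}"
proof -
  have p: "\<Union>P = V" "disjoint P" "{} \<notin> P"
    using assms by (auto simp: multipartition_def partition_on_def)
  have nonadj: "\<not> E x y \<longleftrightarrow> (\<exists>A\<in>P. x \<in> A \<and> y \<in> A)" if "x \<in> V" "y \<in> V" for x y
    using assms that by (auto simp: multipartition_def)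
  have part: "{y \<in> V. \<not> E x y} = A" if "A \<in> P" "x \<in> A" for A x
  proof -
    have "B = A" if "B \<in> P" "x \<in> B" for B
      using p(2) \<open>A \<in> P\<close> \<open>x \<in> A\<close> that by (auto simp: disjoint_def)
    moreover have "x \<in> V" "A \<subseteq> V" using that p(1) by auto
    ultimately show ?thesis using nonadj[of x] that by blast
  qed
  show ?thesis
  proof (intro equalityI subsetI)
    fix A assume "A \<in> P"
    then have "A \<noteq> {}" using p(3) by blast
    then obtain x where "x \<in> A" by blast
    with \<open>A \<in> P\<close> have "x \<in> V" using p(1) by auto
    with \<open>A \<in> P\<close> \<open>x \<in> A\<close> show "A \<in> {{y \<in> V. \<not> E x y} | x. x \<in> V}" using part by blast
  next
    fix A assume "A \<in> {{y \<in> V. \<not> E x y} | x. x \<in> V}"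
    then obtain x where x: "x \<in> V" "A = {y \<in> V. \<not> E x y}" by blast
    then obtain B where "B \<in> P" "x \<in> B" using p(1) by blast
    then show "A \<in> P" using part x by metis
  qed
qed

lemma num_parts_eq:
  assumes "multipartition V E P"
  shows "num_parts V E = card P"
proof -
  have "Q = P" if "multipartition V E Q" for Q
    using multipartition_eq[OF that] multipartition_eq[OF assms] by simp
  then have "(THE Q. multipartition V E Q) = P"
    using assms by (intro the_equality)
  then show ?thesis by (simp add: num_parts_def)
qed

definition param_s :: "'a set \<Rightarrow> ('a \<Rightarrow> 'a \<Rightarrow> bool) \<Rightarrow> nat \<Rightarrow> nat \<Rightarrow> real" where
  "param_s V E k l =
     (if complete_multipartite V E then real (num_parts V E) - 1
      else let v = real (card V); b = real k ^ 2 - k + l - v * l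
           in (- b + sqrt (b^2 + 4 * real k * (v - k - 1) * (v + l - 2 * k))) / (2 * (v + l - 2 * k)))"

definition param_e :: "'a set \<Rightarrow> ('a \<Rightarrow> 'a \<Rightarrow> bool) \<Rightarrow> nat \<Rightarrow> nat \<Rightarrow> real" where
  "param_e V E k l = (let s = param_s V E k l in
     (s + 1) * (real k - s) / (real (card V) - (s + 1)))"

end

(* Let c = s + 1 be the order of a regular clique and m = e its nexus.  The numbers of vertices of
   a clique adjacent to the vertices outside it have first and second moments determined by the
   order of the clique, so every clique of order c is regular with nexus m, and two distinct such
   cliques share at most m vertices.  By hypothesis every clique of order m + 1 thus lies in exactly one
   clique of order c.  Write deg X for the number of c-cliques containing X.  If y and w are distinct
   and non-adjacent, sending a c-clique D through y to the c-clique spanned by w and the m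
   neighbours of w in D shows deg (X + y) = deg (X + w) for every set X of common neighbours.
   Counting pairs (D, w) with w a non-neighbour of y in D then gives, with h = c - m,
     h * deg X = (h + number of non-neighbours of y in the common neighbourhood of X) * deg (X + y),
   so deg is constant on vertices and on edges, and m * deg {x} = sum of deg {x, z} over the common
   neighbours z of non-adjacent x, w fixes the number of these z. *)

theory Submission
  imports Defs
begin

lemma edge_sym: "simple_graph V E \<Longrightarrow> E x y \<longleftrightarrow> E y x"
  by (auto simp: simple_graph_def)

lemma edge_irrefl: "simple_graph V E \<Longrightarrow> \<not> E x x"
  by (auto simp: simple_graph_def)

lemma clique_finite: "simple_graph V E \<Longrightarrow> clique V E D \<Longrightarrow> finite D"
  by (auto simp: simple_graph_def clique_def intro: finite_subset)

section \<open>Counting blocks, the members of a family \<D> of cliques of equal order and equal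
  nexus\<close>

locale clique_geometry =
  fixes V :: "'a set" and E :: "'a \<Rightarrow> 'a \<Rightarrow> bool" and \<D> :: "'a set set" and c m :: nat
  assumes graph: "simple_graph V E"
    and clique: "D \<in> \<D> \<Longrightarrow> clique V E D"
    and size: "D \<in> \<D> \<Longrightarrow> card D = c"
    and nexus: "D \<in> \<D> \<Longrightarrow> w \<in> V - D \<Longrightarrow> card (nbhd V E w \<inter> D) = m"
    and extend: "clique V E K \<Longrightarrow> card K = m + 1 \<Longrightarrow> \<exists>D\<in>\<D>. K \<subseteq> D"
begin

definition deg :: "'a set \<Rightarrow> nat" where
  "deg X = card {D \<in> \<D>. X \<subseteq> D}"

lemma finite_V: "finite V"
  using graph by (simp add: simple_graph_def)

lemma finite_family: "finite \<D>"
  using clique finite_V by (auto intro!: finite_subset[of \<D> "Pow V"] simp: clique_def)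

lemma finite_block: "D \<in> \<D> \<Longrightarrow> finite D"
  using clique clique_finite graph by blast

lemma block_subset: "D \<in> \<D> \<Longrightarrow> D \<subseteq> V"
  using clique by (auto simp: clique_def)

lemma block_adjacent: "D \<in> \<D> \<Longrightarrow> x \<in> D \<Longrightarrow> y \<in> D \<Longrightarrow> x \<noteq> y \<Longrightarrow> E x y"
  using clique by (auto simp: clique_def)

text \<open>A vertex of \<open>D2\<close> outside \<open>D1\<close> would be adjacent to all of
  \<open>K\<close>, hence to more than \<open>m\<close> vertices of \<open>D1\<close>, against the
  nexus.\<close>

lemma block_subset_block:
  assumes D: "D1 \<in> \<D>" "D2 \<in> \<D>" and K: "K \<subseteq> D1" "K \<subseteq> D2" "card K > m"
  shows "D2 \<subseteq> D1"
proof
  fix z assume z: "z \<in> D2"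
  show "z \<in> D1"
  proof (rule ccontr)
    assume n: "z \<notin> D1"
    then have "card (nbhd V E z \<inter> D1) = m"
      using nexus[OF D(1)] z block_subset[OF D(2)] by auto
    moreover have "K \<subseteq> nbhd V E z \<inter> D1"
      using K n z block_adjacent[OF D(2) z] block_subset[OF D(2)] by (auto simp: nbhd_def)
    then have "card K \<le> card (nbhd V E z \<inter> D1)"
      using finite_block[OF D(1)] by (intro card_mono) auto
    ultimately show False using K(3) by simp
  qed
qed

lemma block_unique:
  assumes "D1 \<in> \<D>" "D2 \<in> \<D>" "K \<subseteq> D1" "K \<subseteq> D2" "card K > m"
  shows "D1 = D2"
  using block_subset_block[of D1 D2 K] block_subset_block[of D2 D1 K] assms by blast

text \<open>The map \<open>f\<close> from blocks through \<open>y\<close> to blocks through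
  \<open>w\<close> is injective because \<open>f D\<close> remembers the neighbours of
  \<open>w\<close> in \<open>D\<close>: they are exactly the neighbours of \<open>y\<close> in
  \<open>f D\<close>. Together with \<open>y\<close> these are \<open>m + 1\<close> vertices, enough
  to determine \<open>D\<close>. Since \<open>X\<close> consists of neighbours of \<open>w\<close>,
  a block containing \<open>X\<close> is sent to a block containing \<open>X\<close>.\<close>

lemma deg_nonadjacent_le:
  assumes yw: "y \<in> V" "w \<in> V" "y \<noteq> w" "\<not> E y w"
    and X: "X \<subseteq> nbhd V E y \<inter> nbhd V E w"
  shows "deg (insert y X) \<le> deg (insert w X)"
proof -
  have wy: "\<not> E w y" using yw edge_sym[OF graph] by blast
  have avoid: "w \<in> V - D" "card (nbhd V E w \<inter> D) = m" if "D \<in> \<D>" "y \<in> D" for D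
    using block_adjacent[OF that, of w] nexus[OF that(1), of w] yw by auto
  have ex: "\<exists>D'\<in>\<D>. insert w (nbhd V E w \<inter> D) \<subseteq> D'" if D: "D \<in> \<D>" "y \<in> D" for D
  proof (rule extend)
    show "clique V E (insert w (nbhd V E w \<inter> D))"
      using clique[OF D(1)] yw(2) edge_sym[OF graph] by (auto simp: clique_def nbhd_def)
    show "card (insert w (nbhd V E w \<inter> D)) = m + 1"
      using avoid[OF D] finite_block[OF D(1)] by (subst card_insert_disjoint) auto
  qed
  then obtain f where f: "f D \<in> \<D>" "insert w (nbhd V E w \<inter> D) \<subseteq> f D"
    if "D \<in> \<D>" "y \<in> D" for D by metis
  \<comment> \<open>One inclusion holds because \<open>y\<close> is in \<open>D\<close> and is not
    itself a neighbour of \<open>w\<close>. Equality follows since \<open>y\<close> is not in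
    \<open>f D\<close>, so both sides have \<open>m\<close> elements.\<close>
  have trace: "nbhd V E y \<inter> f D = nbhd V E w \<inter> D" if D: "D \<in> \<D>" "y \<in> D" for D
  proof (rule card_subset_eq[symmetric])
    show "nbhd V E w \<inter> D \<subseteq> nbhd V E y \<inter> f D"
      using f[OF D] block_adjacent[OF D] wy by (auto simp: nbhd_def)
    have "y \<in> V - f D"
      using block_adjacent[OF f(1)[OF D], of w y] f(2)[OF D] wy yw by auto
    then show "card (nbhd V E w \<inter> D) = card (nbhd V E y \<inter> f D)"
      using avoid[OF D] nexus[OF f(1)[OF D]] by simp
    show "finite (nbhd V E y \<inter> f D)" using finite_block[OF f(1)[OF D]] by simp
  qed
  show ?thesis unfolding deg_def
  proof (rule card_inj_on_le)
    show "f ` {D \<in> \<D>. insert y X \<subseteq> D} \<subseteq> {D \<in> \<D>. insert w X \<subseteq> D}"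
      using f X by blast
    show "finite {D \<in> \<D>. insert w X \<subseteq> D}" using finite_family by simp
    show "inj_on f {D \<in> \<D>. insert y X \<subseteq> D}"
    proof (rule inj_onI)
      fix D1 D2
      assume "D1 \<in> {D \<in> \<D>. insert y X \<subseteq> D}" "D2 \<in> {D \<in> \<D>. insert y X \<subseteq> D}"
        and eq: "f D1 = f D2"
      then have D: "D1 \<in> \<D>" "y \<in> D1" "D2 \<in> \<D>" "y \<in> D2" by auto
      have t: "nbhd V E w \<inter> D1 = nbhd V E w \<inter> D2"
        using trace[OF D(1,2)] trace[OF D(3,4)] eq by simp
      show "D1 = D2"
      proof (rule block_unique[OF D(1,3)])
        show "insert y (nbhd V E w \<inter> D1) \<subseteq> D1" "insert y (nbhd V E w \<inter> D1) \<subseteq> D2"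
          using t D by auto
        show "card (insert y (nbhd V E w \<inter> D1)) > m"
          using avoid[OF D(1,2)] finite_block[OF D(1)] wy
          by (subst card_insert_disjoint) (auto simp: nbhd_def)
      qed
    qed
  qed
qed

lemma deg_nonadjacent:
  assumes "y \<in> V" "w \<in> V" "y \<noteq> w" "\<not> E y w" "X \<subseteq> nbhd V E y \<inter> nbhd V E w"
  shows "deg (insert y X) = deg (insert w X)"
  using deg_nonadjacent_le[of y w X] deg_nonadjacent_le[of w y X] assms edge_sym[OF graph]
  by (auto intro: antisym)

text \<open>Double counting of pairs (\<open>D\<close>, \<open>w\<close>), where \<open>D\<close> is
  a block containing \<open>X\<close> but not \<open>y\<close>, and \<open>w\<close> in
  \<open>D\<close> is a non-neighbour of \<open>y\<close>. The number of such blocks is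
  \<open>deg X - deg (insert y X)\<close>; adding the missing multiple of
  \<open>deg (insert y X)\<close> to both sides gives an identity free of this subtraction.\<close>

lemma deg_insert:
  assumes y: "y \<in> V" and X: "X \<subseteq> nbhd V E y"
  shows "(c - m) * deg X =
    (c - m + card {w \<in> V. (\<forall>x\<in>X. E x w) \<and> w \<noteq> y \<and> \<not> E y w}) * deg (insert y X)"
proof -
  define W where "W = {w \<in> V. (\<forall>x\<in>X. E x w) \<and> w \<noteq> y \<and> \<not> E y w}"
  define F where "F = {D \<in> \<D>. X \<subseteq> D \<and> y \<notin> D}"
  have fin: "finite W" "finite F" using finite_V finite_family by (auto simp: W_def F_def)
  have "card {w \<in> W. w \<in> D} = c - m" if D: "D \<in> F" for D
  proof -
    have D': "D \<in> \<D>" "X \<subseteq> D" "y \<notin> D" using D by (auto simp: F_def)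
    \<comment> \<open>A non-neighbour of \<open>y\<close> lies outside \<open>X\<close>, so within
      the clique \<open>D\<close> it is adjacent to all of \<open>X\<close>. Hence the adjacency
      condition in \<open>W\<close> excludes no non-neighbour of \<open>y\<close> in
      \<open>D\<close>.\<close>
    have "E x z" if "x \<in> X" "z \<in> D" "\<not> E y z" for x z
      using block_adjacent[OF D'(1), of x z] that X D'(2) by (auto simp: nbhd_def)
    then have "{w \<in> W. w \<in> D} = D - (nbhd V E y \<inter> D)"
      using D' block_subset[OF D'(1)] X
      by (auto simp: W_def nbhd_def subset_iff)
    then show ?thesis
      using finite_block[OF D'(1)] size[OF D'(1)] nexus[OF D'(1), of y] y D'(3)
      by (simp add: card_Diff_subset)
  qed
  moreover have "card {D \<in> F. w \<in> D} = deg (insert y X)" if w: "w \<in> W" for w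
  proof -
    \<comment> \<open>A block through \<open>w\<close> cannot contain the non-neighbour
      \<open>y\<close>, so the condition defining \<open>F\<close> reduces to containing
      \<open>X\<close>.\<close>
    have "{D \<in> F. w \<in> D} = {D \<in> \<D>. insert w X \<subseteq> D}"
      using w block_adjacent[of _ y w] by (auto simp: F_def W_def)
    moreover have "deg (insert y X) = deg (insert w X)"
      using w X edge_sym[OF graph] by (intro deg_nonadjacent y) (auto simp: W_def nbhd_def)
    ultimately show ?thesis by (simp add: deg_def)
  qed
  ultimately have count: "(c - m) * card F = card W * deg (insert y X)"
    using sum_multicount_gen[OF fin(2,1), of "\<lambda>D w. w \<in> D" "\<lambda>_. deg (insert y X)"]
    by (simp add: mult.commute)
  have "{D \<in> \<D>. X \<subseteq> D} = F \<union> {D \<in> \<D>. insert y X \<subseteq> D}"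
    by (auto simp: F_def)
  then have "deg X = card F + deg (insert y X)"
    unfolding deg_def using finite_family by (simp add: F_def, subst card_Un_disjoint) auto
  then show ?thesis using count by (simp add: W_def algebra_simps)
qed

text \<open>Pairs (\<open>D\<close>, \<open>z\<close>) with \<open>x\<close> and \<open>z\<close> in
  \<open>D\<close> are counted. A block through \<open>x\<close> misses \<open>w\<close>, and all
  \<open>m\<close> neighbours of \<open>w\<close> in it are also neighbours of
  \<open>x\<close>.\<close>

lemma deg_common_neighbours:
  assumes "x \<in> V" "w \<in> V" "x \<noteq> w" "\<not> E x w"
  shows "m * deg {x} = (\<Sum>z\<in>nbhd V E x \<inter> nbhd V E w. deg {x, z})"
proof -
  let ?N = "nbhd V E x \<inter> nbhd V E w" and ?F = "{D \<in> \<D>. x \<in> D}"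
  have "card {z \<in> ?N. z \<in> D} = m" if D: "D \<in> ?F" for D
  proof -
    have "{z \<in> ?N. z \<in> D} = nbhd V E w \<inter> D"
      using D assms block_adjacent[of D x] edge_sym[OF graph] by (auto simp: nbhd_def)
    then show ?thesis using D nexus[of D w] block_adjacent[of D x w] assms by auto
  qed
  moreover have "card {D \<in> ?F. z \<in> D} = deg {x, z}" for z
    unfolding deg_def by (rule arg_cong[of _ _ card]) auto
  moreover have "finite ?F" "finite ?N" using finite_family finite_V by (auto simp: nbhd_def)
  ultimately show ?thesis
    using sum_multicount_gen[of ?F ?N "\<lambda>D z. z \<in> D" "\<lambda>z. deg {x, z}"]
    by (simp add: deg_def mult.commute)
qed

lemma common_neighbours_nonadjacent:
  assumes er: "edge_regular V E k l" and ne: "\<D> \<noteq> {}" and cm: "m < c"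
    and xw: "x \<in> V" "w \<in> V" "x \<noteq> w" "\<not> E x w"
  shows "(c - m) * card (nbhd V E x \<inter> nbhd V E w) = m * (c - m + (k - 1 - l))"
proof -
  \<comment> \<open>\<open>deg {}\<close> is the number of all blocks; \<open>deg_insert\<close>
    with the empty set passes its positivity on to \<open>deg {x}\<close>, which is cancelled at the
    end.\<close>
  have "0 < deg {}" using ne finite_family by (auto simp: deg_def card_gt_0_iff)
  then have pos: "0 < deg {x}"
    using deg_insert[of x "{}"] xw cm by (cases "deg {x} = 0") auto
  have edge: "(c - m) * deg {x} = (c - m + (k - 1 - l)) * deg {x, z}" if z: "z \<in> nbhd V E x" for z
  proof -
    have z': "z \<in> V" "E x z" "E z x" using z edge_sym[OF graph] by (auto simp: nbhd_def)
    \<comment> \<open>Of the \<open>k\<close> neighbours of \<open>x\<close>, the vertex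
      \<open>z\<close> and the \<open>l\<close> common neighbours of \<open>x\<close> and
      \<open>z\<close> drop out.\<close>
    have "{u \<in> V. (\<forall>y\<in>{x}. E y u) \<and> u \<noteq> z \<and> \<not> E z u}
      = nbhd V E x - insert z (nbhd V E x \<inter> nbhd V E z)"
      by (auto simp: nbhd_def)
    also have "card \<dots> = card (nbhd V E x) - card (insert z (nbhd V E x \<inter> nbhd V E z))"
      using z finite_V by (intro card_Diff_subset) (auto simp: nbhd_def)
    also have "card (insert z (nbhd V E x \<inter> nbhd V E z)) = l + 1"
      using er xw(1) z' finite_V edge_irrefl[OF graph]
      by (subst card_insert_disjoint) (auto simp: nbhd_def edge_regular_def)
    also have "card (nbhd V E x) - (l + 1) = k - 1 - l"
      using er xw(1) by (simp add: edge_regular_def regular_graph_def)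
    finally show ?thesis
      using deg_insert[of z "{x}"] z' xw(1) by (simp add: nbhd_def insert_commute)
  qed
  let ?N = "nbhd V E x \<inter> nbhd V E w"
  have "m * (c - m + (k - 1 - l)) * deg {x} = (\<Sum>z\<in>?N. (c - m + (k - 1 - l)) * deg {x, z})"
    unfolding sum_distrib_left[symmetric] deg_common_neighbours[OF xw, symmetric] by (simp only: mult_ac)
  also have "\<dots> = (\<Sum>z\<in>?N. (c - m) * deg {x})"
    using edge by (intro sum.cong) auto
  also have "\<dots> = (c - m) * card ?N * deg {x}" by simp
  finally show ?thesis using pos by simp
qed

end

section \<open>Moments of the numbers of neighbours in a clique\<close>

lemma clique_first_moment:
  assumes er: "edge_regular V E k l" and D: "clique V E D"
  shows "(\<Sum>w\<in>V - D. real (card (nbhd V E w \<inter> D))) = card D * (real k - (real (card D) - 1))"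
    and clique_second_moment: "(\<Sum>w\<in>V - D. (real (card (nbhd V E w \<inter> D)))\<^sup>2) =
      card D * ((real k - (real (card D) - 1))
        + (real (card D) - 1) * (real l - (real (card D) - 2)))"
proof -
  have g: "simple_graph V E" using er by (simp add: edge_regular_def regular_graph_def)
  then have finV: "finite V" by (simp add: simple_graph_def)
  have finD: "finite D" using clique_finite[OF g D] .
  have DV: "D \<subseteq> V" using D by (simp add: clique_def)
  have one: "real (card (nbhd V E x - D)) = real k - (real (card D) - 1)" if x: "x \<in> D" for x
  proof -
    have "nbhd V E x \<inter> D = D - {x}"
      using D x edge_irrefl[OF g] by (auto simp: clique_def nbhd_def)
    moreover have "card (nbhd V E x) = k"
      using er x DV by (auto simp: edge_regular_def regular_graph_def)
    moreover have "card (nbhd V E x) = card (nbhd V E x \<inter> D) + card (nbhd V E x - D)"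
      using finV by (subst card_Un_disjoint[symmetric]) (auto simp: nbhd_def intro!: arg_cong[of _ _ card])
    moreover have "card D > 0" using x finD by (auto simp: card_gt_0_iff)
    ultimately show ?thesis using x finD by (simp add: of_nat_diff)
  qed
  have two: "real (card (nbhd V E x \<inter> nbhd V E y - D)) = real l - (real (card D) - 2)"
    if xy: "x \<in> D" "y \<in> D" "x \<noteq> y" for x y
  proof -
    let ?N = "nbhd V E x \<inter> nbhd V E y"
    have "?N \<inter> D = D - {x, y}"
      using D xy edge_irrefl[OF g] by (auto simp: clique_def nbhd_def)
    moreover have "card (D - {x, y}) + card {x, y} = card D"
      using xy finD card_mono[of D "{x, y}"] by (subst card_Diff_subset) auto
    moreover have "card ?N = l"
      using er D xy by (simp add: edge_regular_def clique_def subset_iff)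
    moreover have "card ?N = card (?N \<inter> D) + card (?N - D)"
      using finV by (subst card_Un_disjoint[symmetric]) (auto simp: nbhd_def intro!: arg_cong[of _ _ card])
    ultimately show ?thesis using xy by simp
  qed
  \<comment> \<open>As a sum of indicators over \<open>D\<close>, the number of neighbours has a
    square that is a sum over ordered pairs in \<open>D\<close>; exchanging the sums turns the
    moments into counts of neighbours outside \<open>D\<close>.\<close>
  have d: "real (card (nbhd V E w \<inter> D)) = (\<Sum>x\<in>D. of_bool (w \<in> nbhd V E x))" if "w \<in> V" for w
  proof -
    have "nbhd V E w \<inter> D = {x \<in> D. w \<in> nbhd V E x}"
      using that DV edge_sym[OF g] by (auto simp: nbhd_def)
    then show ?thesis using finD by (simp add: sum.If_cases of_bool_def Int_def)
  qed
  have count: "(\<Sum>w\<in>V - D. of_bool (w \<in> A)) = real (card (A - D))" if "A \<subseteq> V" for A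
  proof -
    have "(V - D) \<inter> {w. w \<in> A} = A - D" using that by auto
    then show ?thesis using finV by (simp add: sum.If_cases of_bool_def)
  qed
  have "(\<Sum>w\<in>V - D. real (card (nbhd V E w \<inter> D))) = (\<Sum>x\<in>D. \<Sum>w\<in>V - D. of_bool (w \<in> nbhd V E x))"
    by (subst sum.swap) (auto intro!: sum.cong simp: d)
  also have "\<dots> = (\<Sum>x\<in>D. real k - (real (card D) - 1))"
  proof (intro sum.cong refl)
    fix x assume "x \<in> D"
    moreover have "nbhd V E x \<subseteq> V" by (auto simp: nbhd_def)
    ultimately show "(\<Sum>w\<in>V - D. of_bool (w \<in> nbhd V E x)) = real k - (real (card D) - 1)"
      using one count by simp
  qed
  finally show "(\<Sum>w\<in>V - D. real (card (nbhd V E w \<inter> D))) = card D * (real k - (real (card D) - 1))"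
    by simp
  have "(\<Sum>w\<in>V - D. (real (card (nbhd V E w \<inter> D)))\<^sup>2)
      = (\<Sum>w\<in>V - D. \<Sum>x\<in>D. \<Sum>y\<in>D. of_bool (w \<in> nbhd V E x \<inter> nbhd V E y))"
    by (intro sum.cong refl) (simp add: d power2_eq_square sum_product of_bool_conj)
  also have "\<dots> = (\<Sum>x\<in>D. \<Sum>w\<in>V - D. \<Sum>y\<in>D. of_bool (w \<in> nbhd V E x \<inter> nbhd V E y))"
    by (rule sum.swap)
  also have "\<dots> = (\<Sum>x\<in>D. \<Sum>y\<in>D. \<Sum>w\<in>V - D. of_bool (w \<in> nbhd V E x \<inter> nbhd V E y))"
    by (rule sum.cong[OF refl], rule sum.swap)
  also have "\<dots> = (\<Sum>x\<in>D. \<Sum>y\<in>D. real (card (nbhd V E x \<inter> nbhd V E y - D)))"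
    by (intro sum.cong refl count) (auto simp: nbhd_def)
  also have "\<dots> = (\<Sum>x\<in>D. (real k - (real (card D) - 1))
        + (real (card D) - 1) * (real l - (real (card D) - 2)))"
  proof (intro sum.cong refl)
    fix x assume x: "x \<in> D"
    have "card D > 0" using x finD by (auto simp: card_gt_0_iff)
    \<comment> \<open>The diagonal term \<open>y = x\<close> is evaluated by \<open>one\<close>, the
      others by \<open>two\<close>.\<close>
    have "(\<Sum>y\<in>D. real (card (nbhd V E x \<inter> nbhd V E y - D))) =
      real (card (nbhd V E x - D)) + (\<Sum>y\<in>D - {x}. real (card (nbhd V E x \<inter> nbhd V E y - D)))"
      using x finD by (simp add: sum.remove)
    also have "(\<Sum>y\<in>D - {x}. real (card (nbhd V E x \<inter> nbhd V E y - D))) =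
      (\<Sum>y\<in>D - {x}. real l - (real (card D) - 2))"
      using x by (intro sum.cong refl two) auto
    also have "\<dots> = (real (card D) - 1) * (real l - (real (card D) - 2))"
      using x finD \<open>card D > 0\<close> by (simp add: of_nat_diff)
    finally show "(\<Sum>y\<in>D. real (card (nbhd V E x \<inter> nbhd V E y - D))) = (real k - (real (card D) - 1))
        + (real (card D) - 1) * (real l - (real (card D) - 2))"
      using one[OF x] by simp
  qed
  finally show "(\<Sum>w\<in>V - D. (real (card (nbhd V E w \<inter> D)))\<^sup>2) =
      card D * ((real k - (real (card D) - 1))
        + (real (card D) - 1) * (real l - (real (card D) - 2)))"
    by simp
qed

text \<open>The sum of squared deviations from \<open>m\<close> depends only on the two moments and
  the number of outside vertices, hence only on the order of the clique. It vanishes for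
  \<open>C\<close>, so every deviation vanishes for \<open>D\<close>.\<close>

lemma same_order_regular_clique:
  assumes er: "edge_regular V E k l"
    and C: "clique V E C" and reg: "\<forall>w\<in>V - C. card (nbhd V E w \<inter> C) = m"
    and D: "clique V E D" "card D = card C" and w: "w \<in> V - D"
  shows "card (nbhd V E w \<inter> D) = m"
proof -
  have g: "simple_graph V E" using er by (simp add: edge_regular_def regular_graph_def)
  then have finV: "finite V" by (simp add: simple_graph_def)
  define M where "M K = (\<Sum>w\<in>V - K. (real (card (nbhd V E w \<inter> K)) - m)\<^sup>2)" for K
  have M: "M K = (\<Sum>w\<in>V - K. (real (card (nbhd V E w \<inter> K)))\<^sup>2)
     - 2 * m * (\<Sum>w\<in>V - K. real (card (nbhd V E w \<inter> K))) + m\<^sup>2 * card (V - K)" for K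
    unfolding M_def power2_diff
    by (simp add: sum.distrib sum_subtractf sum_distrib_left algebra_simps)
  have "card (V - D) = card (V - C)"
    using C D finV clique_finite[OF g] by (simp add: card_Diff_subset clique_def)
  then have "M D = M C"
    unfolding M clique_first_moment[OF er C] clique_first_moment[OF er D(1)]
      clique_second_moment[OF er C] clique_second_moment[OF er D(1)] D(2) by simp
  also have "M C = 0" unfolding M_def using reg by (intro sum.neutral) simp
  finally have "\<forall>w\<in>V - D. (real (card (nbhd V E w \<inter> D)) - m)\<^sup>2 = 0"
    unfolding M_def using finV by (subst (asm) sum_nonneg_eq_0_iff) auto
  then show ?thesis using w by auto
qed

section \<open>Complete multipartite graphs, and the meaning of the parameters s and e\<close>

lemma complete_multipartite_nbhd_eq:
  assumes "complete_multipartite V E" "x \<in> V" "y \<in> V" "\<not> E x y"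
  shows "nbhd V E x = nbhd V E y"
proof -
  obtain P where P: "disjoint P"
    "\<And>x y. x \<in> V \<Longrightarrow> y \<in> V \<Longrightarrow> E x y \<longleftrightarrow> \<not> (\<exists>A\<in>P. x \<in> A \<and> y \<in> A)"
    using assms(1) by (auto simp: complete_multipartite_def multipartition_def partition_on_def)
  obtain A where A: "A \<in> P" "x \<in> A" "y \<in> A" using P(2) assms by blast
  have "B = A" if "B \<in> P" "z \<in> A" "z \<in> B" for B z
    using P(1) A(1) that by (auto simp: disjoint_def)
  then show ?thesis using A P(2) assms(2,3) unfolding nbhd_def by blast
qed

text \<open>The assumption \<open>trans\<close> is the contrapositive of transitivity of
  non-adjacency; the parts are the classes of that equivalence.\<close>

lemma complete_multipartiteI:
  assumes g: "simple_graph V E"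
    and trans: "\<And>x y z. x \<in> V \<Longrightarrow> y \<in> V \<Longrightarrow> z \<in> V \<Longrightarrow> E x z \<Longrightarrow> E x y \<or> E y z"
  shows "complete_multipartite V E"
proof -
  define r where "r = {(x, y). x \<in> V \<and> y \<in> V \<and> \<not> E x y}"
  have eq: "equiv V r"
  proof (rule equivI)
    show "trans r"
      using trans unfolding r_def by (intro transI) blast
  qed (use edge_irrefl[OF g] edge_sym[OF g] in \<open>auto simp: r_def refl_on_def sym_def\<close>)
  then have "partition_on V (V // r)"
    by (rule partition_on_quotient)
  moreover have "E x y \<longleftrightarrow> \<not> (\<exists>A\<in>V // r. x \<in> A \<and> y \<in> A)" if "x \<in> V" "y \<in> V" for x y
  proof -
    have "(\<exists>A\<in>V // r. x \<in> A \<and> y \<in> A) \<longleftrightarrow> (x, y) \<in> r"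
      using quotient_eq_iff[OF eq, of _ _ x y] quotientI[OF that(1), of r]
        equiv_class_self[OF eq that(1)] by blast
    then show ?thesis using that by (simp add: r_def)
  qed
  ultimately show ?thesis
    unfolding complete_multipartite_def multipartition_def by blast
qed

text \<open>Some edge has a vertex adjacent to neither end, so the \<open>2 * k - l\<close> vertices
  adjacent to at least one end do not exhaust \<open>V\<close>. This makes the leading coefficient
  of the quadratic for s positive.\<close>

lemma edge_regular_order_gt:
  assumes er: "edge_regular V E k l" and ncm: "\<not> complete_multipartite V E"
  shows "2 * k < card V + l"
proof -
  have g: "simple_graph V E" using er by (simp add: edge_regular_def regular_graph_def)
  then have finV: "finite V" by (simp add: simple_graph_def)
  obtain x y z where xyz: "x \<in> V" "y \<in> V" "z \<in> V" "E x z" "\<not> E x y" "\<not> E z y"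
    using ncm complete_multipartiteI[OF g] edge_sym[OF g] by blast
  have "card (nbhd V E x) + card (nbhd V E z)
    = card (nbhd V E x \<union> nbhd V E z) + card (nbhd V E x \<inter> nbhd V E z)"
    using finV by (intro card_Un_Int) (auto simp: nbhd_def)
  moreover have "card (nbhd V E x \<union> nbhd V E z) < card V"
    using finV xyz by (intro psubset_card_mono) (auto simp: nbhd_def)
  moreover have "card (nbhd V E x) = k" "card (nbhd V E z) = k" "card (nbhd V E x \<inter> nbhd V E z) = l"
    using er xyz by (auto simp: edge_regular_def regular_graph_def)
  ultimately show ?thesis by simp
qed

lemma valency_less:
  assumes "regular_graph V E k" "\<not> complete_graph V E"
  shows "k + 1 < card V"
proof -
  have g: "simple_graph V E" "finite V" using assms(1)
    by (auto simp: regular_graph_def simple_graph_def)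
  obtain x y where xy: "x \<in> V" "y \<in> V" "x \<noteq> y" "\<not> E x y"
    using assms(2) by (auto simp: complete_graph_def)
  have "insert x (nbhd V E x) \<subset> V" using xy by (auto simp: nbhd_def)
  then have "card (insert x (nbhd V E x)) < card V" using g by (intro psubset_card_mono)
  then show ?thesis
    using assms(1) xy(1) g edge_irrefl[OF g(1)]
    by (subst (asm) card_insert_disjoint) (auto simp: nbhd_def regular_graph_def)
qed

text \<open>Since \<open>p > 0\<close>, the factor \<open>a * s + b\<close> is positive, so
  \<open>2 * a * s + b\<close> is the nonnegative square root of the discriminant; this selects the
  plus sign.\<close>

lemma positive_root_eq:
  fixes a b p s :: real
  assumes "a > 0" "p > 0" "s \<ge> 0" "a * s\<^sup>2 + b * s = p"
  shows "s = (- b + sqrt (b\<^sup>2 + 4 * a * p)) / (2 * a)"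
proof -
  have "s * (a * s + b) > 0" using assms by (simp add: power2_eq_square algebra_simps)
  then have "a * s + b > 0" using assms(3) by (simp add: zero_less_mult_iff)
  then have "2 * a * s + b \<ge> 0" using assms mult_nonneg_nonneg[of a s] by linarith
  moreover have "(2 * a * s + b)\<^sup>2 = b\<^sup>2 + 4 * a * p"
    unfolding assms(4)[symmetric] by (simp add: power2_eq_square algebra_simps)
  ultimately have "sqrt (b\<^sup>2 + 4 * a * p) = 2 * a * s + b"
    by (metis real_sqrt_abs abs_of_nonneg)
  then show ?thesis using assms(1) by (simp add: field_simps)
qed

lemma regular_clique_parameters:
  assumes er: "edge_regular V E k l" and nc: "\<not> complete_graph V E"
    and ncm: "\<not> complete_multipartite V E" and k: "k > 0"
    and C: "clique V E C" "C \<noteq> {}" and reg: "\<forall>w\<in>V - C. card (nbhd V E w \<inter> C) = m"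
  shows "param_s V E k l = real (card C) - 1" and "param_e V E k l = m"
proof -
  have rg: "regular_graph V E k" using er by (simp add: edge_regular_def)
  then have g: "simple_graph V E" "finite V" by (auto simp: regular_graph_def simple_graph_def)
  define s where "s = real (card C) - 1"
  define v where "v = real (card V)"
  have finC: "finite C" using clique_finite[OF g(1) C(1)] .
  have CV: "C \<subset> V"
    using C nc by (auto simp: clique_def complete_graph_def)
  have "card C > 0" using C finC by (simp add: card_gt_0_iff)
  then have s0: "s \<ge> 0" by (simp add: s_def)
  have less: "card C < card V" using CV g by (simp add: psubset_card_mono)
  have out: "real (card (V - C)) = v - (s + 1)"
    using CV finC less by (simp add: card_Diff_subset psubset_imp_subset of_nat_diff s_def v_def)
  have m1: "m * (v - (s + 1)) = (s + 1) * (k - s)"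
    using clique_first_moment[OF er C(1)] reg out by (simp add: s_def mult.commute)
  have m2: "m * m * (v - (s + 1)) = (s + 1) * ((k - s) + s * (l - s + 1))"
    using clique_second_moment[OF er C(1)] reg out
    by (simp add: s_def power2_eq_square algebra_simps)
  \<comment> \<open>Eliminating \<open>m\<close> between the two moments and cancelling
    \<open>s + 1\<close> leaves an equation whose cubic terms cancel; it becomes the quadratic
    \<open>quad\<close> that underlies \<open>param_s\<close>.\<close>
  have "(s + 1) * ((k - s) + s * (l - s + 1)) * (v - (s + 1)) = (m * (v - (s + 1)))\<^sup>2"
    unfolding m2[symmetric] by (simp add: power2_eq_square)
  also have "\<dots> = (s + 1) * ((s + 1) * (k - s)\<^sup>2)"
    unfolding m1 by (simp add: power2_eq_square)
  finally have "((k - s) + s * (l - s + 1)) * (v - (s + 1)) = (s + 1) * (k - s)\<^sup>2"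
    using s0 by (simp add: mult.assoc)
  then have quad: "(v + l - 2 * k) * s\<^sup>2 + ((real k)\<^sup>2 - k + l - v * l) * s = k * (v - k - 1)"
    by (simp add: power2_eq_square algebra_simps)
  have "real (2 * k) < real (card V + l)" "real (k + 1) < real (card V)"
    using edge_regular_order_gt[OF er ncm] valency_less[OF rg nc] by linarith+
  then have "v + l - 2 * k > 0" "k * (v - k - 1) > 0" using k by (simp_all add: v_def)
  from positive_root_eq[OF this s0 quad] show ps: "param_s V E k l = real (card C) - 1"
    using ncm unfolding param_s_def Let_def v_def[symmetric] s_def[symmetric]
    by (simp only: if_False mult_ac of_nat_mult of_nat_numeral)
  have "v - (s + 1) > 0" using less by (simp add: v_def s_def)
  then have "m = (s + 1) * (k - s) / (v - (s + 1))" using m1 by (simp add: field_simps)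
  then show "param_e V E k l = m"
    unfolding param_e_def Let_def ps by (simp add: s_def v_def)
qed

text \<open>Otherwise every outside vertex is adjacent to all of \<open>C\<close>, so a vertex of
  \<open>C\<close> is adjacent to all other vertices and the valency is too large for a non-complete
  regular graph.\<close>

lemma nexus_less_order:
  assumes rg: "regular_graph V E k" and nc: "\<not> complete_graph V E"
    and C: "clique V E C" "C \<noteq> {}" and reg: "\<forall>w\<in>V - C. card (nbhd V E w \<inter> C) = m"
  shows "m < card C"
proof (rule ccontr)
  assume "\<not> m < card C"
  then have ge: "card C \<le> m" by simp
  have g: "simple_graph V E" using rg by (simp add: regular_graph_def)
  obtain x where x: "x \<in> C" "x \<in> V" using C by (auto simp: clique_def)
  have "V - {x} \<subseteq> nbhd V E x"
  proof
    fix w assume w: "w \<in> V - {x}"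
    show "w \<in> nbhd V E x"
    proof (cases "w \<in> C")
      case True then show ?thesis using C(1) x w by (auto simp: clique_def nbhd_def)
    next
      case False
      then have "card C \<le> card (nbhd V E w \<inter> C)" using reg w ge by simp
      then have "nbhd V E w \<inter> C = C" using clique_finite[OF g C(1)] by (intro card_seteq) auto
      then show ?thesis using x w edge_sym[OF g] by (auto simp: nbhd_def)
    qed
  qed
  moreover have fin: "finite V" using g by (simp add: simple_graph_def)
  ultimately have "card (V - {x}) \<le> card (nbhd V E x)"
    by (intro card_mono) (auto simp: nbhd_def)
  then show False
    using valency_less[OF rg nc] rg x fin by (simp add: regular_graph_def)
qed

section \<open>Common neighbours of non-adjacent vertices in a Neumaier graph\<close>

theorem theorem2p1:
  fixes V :: "'a set" and E :: "'a \<Rightarrow> 'a \<Rightarrow> bool" and k l :: nat and s e :: real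
  assumes "neumaier_graph V E k l"
    and "s = param_s V E k l"
    and "e = param_e V E k l"
    and "\<And>C. clique V E C \<Longrightarrow> real (card C) = e + 1 \<Longrightarrow>
           \<exists>D. clique V E D \<and> real (card D) = s + 1 \<and> C \<subseteq> D"
  shows "strongly_regular V E"
proof -
  obtain C m where er: "edge_regular V E k l" and nc: "\<not> complete_graph V E"
    and C: "clique V E C" and m: "m > 0" and reg: "\<forall>x\<in>V - C. card (nbhd V E x \<inter> C) = m"
    using assms(1) by (auto simp: neumaier_graph_def regular_clique_def)
  have rg: "regular_graph V E k" and g: "simple_graph V E"
    using er by (auto simp: edge_regular_def regular_graph_def)
  obtain w where w: "w \<in> V - C" using nc C by (auto simp: complete_graph_def clique_def)
  then have "nbhd V E w \<inter> C \<noteq> {}" using reg m by (metis card.empty less_irrefl)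
  then obtain y where y: "y \<in> C" "y \<in> V" "E w y" by (auto simp: nbhd_def)
  have "nbhd V E w \<noteq> {}" "finite (nbhd V E w)"
    using y g by (auto simp: nbhd_def simple_graph_def)
  then have k: "k > 0" using rg w by (auto simp: regular_graph_def card_gt_0_iff)
  have "\<exists>\<mu>. \<forall>x\<in>V. \<forall>y\<in>V. x \<noteq> y \<and> \<not> E x y \<longrightarrow> card (nbhd V E x \<inter> nbhd V E y) = \<mu>"
  proof (cases "complete_multipartite V E")
    case True
    \<comment> \<open>Non-adjacent vertices of a complete multipartite graph have the same
      neighbourhood, so the constant is the valency.\<close>
    have "card (nbhd V E x \<inter> nbhd V E y) = k" if "x \<in> V" "y \<in> V" "\<not> E x y" for x y
      using complete_multipartite_nbhd_eq[OF True that] rg that by (simp add: regular_graph_def)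
    then show ?thesis by blast
  next
    case False
    have C0: "C \<noteq> {}" using y by blast
    note par = regular_clique_parameters[OF er nc False k C C0 reg]
    \<comment> \<open>All cliques of the order of \<open>C\<close> are taken. By \<open>par\<close>,
      s + 1 is this order and e is \<open>m\<close>, so the assumption on cliques of order e + 1
      becomes \<open>extend\<close>.\<close>
    define \<D> where "\<D> = {D. clique V E D \<and> card D = card C}"
    interpret clique_geometry V E \<D> "card C" m
    proof
      show "card (nbhd V E w \<inter> D) = m" if "D \<in> \<D>" "w \<in> V - D" for D w
        using same_order_regular_clique[OF er C reg] that by (simp add: \<D>_def)
      show "\<exists>D\<in>\<D>. K \<subseteq> D" if "clique V E K" "card K = m + 1" for K
        using assms(4)[OF that(1)] that(2) par assms(2,3) by (auto simp: \<D>_def)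
    qed (use g in \<open>auto simp: \<D>_def\<close>)
    have cm: "m < card C" by (rule nexus_less_order[OF rg nc C C0 reg])
    have "\<D> \<noteq> {}" using C by (auto simp: \<D>_def)
    \<comment> \<open>The division is exact: \<open>common_neighbours_nonadjacent\<close> writes the
      dividend as a multiple of \<open>card C - m\<close>, which is positive by
      \<open>cm\<close>.\<close>
    have "card (nbhd V E x \<inter> nbhd V E y) = m * (card C - m + (k - 1 - l)) div (card C - m)"
      if "x \<in> V" "y \<in> V" "x \<noteq> y" "\<not> E x y" for x y
      unfolding common_neighbours_nonadjacent[OF er \<open>\<D> \<noteq> {}\<close> cm that, symmetric]
      using cm by simp
    then show ?thesis by blast
  qed
  moreover have "\<exists>x\<in>V. \<exists>y\<in>V. E x y" using w y by blast
  ultimately show ?thesis using er nc by (auto simp: strongly_regular_def)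
qed

end
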